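(* Let $0<\lambda<1$, $0=b_1<b_2<\dots<b_N=1-\lambda$, $\tau_{b_i}(x)=\lambda x+b_i$ on $\mathbb{R}$, weights $p_1,\dots,p_N>0$ summing to $1$, $X\subset[0,1]$ the attractor and $\mu$ the self-similar measure $\mu=\sum_{i=1}^Np_i\mu\circ\tau_{b_i}^{-1}$. Suppose $0<\mathcal{H}^\alpha(X)<\infty$ and $\mu\ll\mathcal{H}^\alpha|_X$. Then: (i) if $\mu$ admits a frame measure, then $p_1=p_N$; (ii) if $\alpha=1$ (i.e. $\mu\ll\mathcal{L}|_X$) and $\mu$ admits a frame measure, then $p_j\le\lambda$ for all $j$ and $p_1=p_N=\lambda$.
   Context: $\mathcal{H}^\alpha$ is $\alpha$-dimensional Hausdorff measure, $\mathcal{L}$ Lebesgue measure; the attractor $X$ is the unique nonempty compact set with $X=\bigcup_i\tau_{b_i}(X)$. A frame measure for $\mu$ is a Borel measure $\nu$ on $\mathbb{R}$ with $A\|f\|_{L^2(\mu)}^2\le\|\widehat{f\,d\mu}\|_{L^2(\nu)}^2\le B\|f\|_{L^2(\mu)}^2$ for all $f\in L^2(\mu)$, some $A,B>0$, with $\widehat{f\,d\mu}(t)=\int f(x)e^{-2\pi itx}d\mu(x)$. *)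

theory Defs
  imports "HOL-Analysis.Analysis"
begin

text \<open>Contribution of a covering set U to the alpha-dimensional Hausdorff sum:
  diam(U)^alpha, with the usual conventions diam({})^alpha = 0 and
  d^0 = 1 for nonempty U.\<close>
definition hd_pow :: "real \<Rightarrow> real set \<Rightarrow> real" where
  "hd_pow \<alpha> U = (if U = {} then 0 else if \<alpha> = 0 then 1 else diameter U powr \<alpha>)"

definition hausdorff_pre :: "real \<Rightarrow> real \<Rightarrow> real set \<Rightarrow> ennreal" where
  "hausdorff_pre \<alpha> \<delta> A =
     (INF U \<in> {U :: nat \<Rightarrow> real set. A \<subseteq> (\<Union>i. U i) \<and>
                  (\<forall>i. bounded (U i) \<and> diameter (U i) \<le> \<delta>)}.
        (\<Sum>i. ennreal (hd_pow \<alpha> (U i))))"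

definition hausdorff_measure :: "real \<Rightarrow> real set \<Rightarrow> ennreal" where
  "hausdorff_measure \<alpha> A = (SUP \<delta> \<in> {0<..}. hausdorff_pre \<alpha> \<delta> A)"

definition hausdorff_abs_cont :: "real measure \<Rightarrow> real \<Rightarrow> real set \<Rightarrow> bool" where
  "hausdorff_abs_cont \<mu> \<alpha> X \<longleftrightarrow>
     (\<forall>A \<in> sets borel. hausdorff_measure \<alpha> (A \<inter> X) = 0 \<longrightarrow> emeasure \<mu> A = 0)"

definition fourier_fmu :: "real measure \<Rightarrow> (real \<Rightarrow> complex) \<Rightarrow> real \<Rightarrow> complex" where
  "fourier_fmu \<mu> f t = integral\<^sup>L \<mu> (\<lambda>x. f x * cis (- 2 * pi * t * x))"

definition frame_measure :: "real measure \<Rightarrow> real measure \<Rightarrow> bool" where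
  "frame_measure \<mu> \<nu> \<longleftrightarrow> sets \<nu> = sets borel \<and>
     (\<exists>A B :: real. 0 < A \<and> 0 < B \<and>
        (\<forall>f :: real \<Rightarrow> complex. f \<in> borel_measurable \<mu> \<and> integrable \<mu> (\<lambda>x. (cmod (f x))\<^sup>2) \<longrightarrow>
           ennreal A * (\<integral>\<^sup>+ x. ennreal ((cmod (f x))\<^sup>2) \<partial>\<mu>)
             \<le> (\<integral>\<^sup>+ t. ennreal ((cmod (fourier_fmu \<mu> f t))\<^sup>2) \<partial>\<nu>) \<and>
           (\<integral>\<^sup>+ t. ennreal ((cmod (fourier_fmu \<mu> f t))\<^sup>2) \<partial>\<nu>)
             \<le> ennreal B * (\<integral>\<^sup>+ x. ennreal ((cmod (f x))\<^sup>2) \<partial>\<mu>)))"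

end

(* A frame measure compares the L2 norms of any two densities f, g whose measures f dmu, g dmu are
   translates of one finite measure rho, because translation only changes the phase of the
   Fourier transform. If the copy f dmu lives on E and g is bounded by c', Cauchy-Schwarz turns
   this into rho(R) <= const * c' * mu(E).

   Let rho be mu scaled by lam^n. Its copy on the j-th branch iterated n times has density at most
   p_j^(-n), while mu charges the n-th piece at an end point of [0,1] with O(p_1^n), resp. O(p_N^n),
   as only the end branch reaches there. So p_j <= p_1 and p_j <= p_N, whence p_1 = p_N.

   If mu is absolutely continuous, X has positive Lebesgue measure, and by averaging some piece of
   level n has mu-mass O(lam^n), so p_j <= lam. For lam <= p_1 compare the left end piece with a
   set on which the density of mu is bounded below. *)
theory Submission
  imports Defs
begin

section \<open>Measures of bounded density and their translates\<close>

text \<open>A setwise way to say that \<open>M\<close> has density at most \<open>c\<close> with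
  respect to \<open>N\<close>. In this form the bound passes through push-forwards and through the
  invariance equation without choosing a density.\<close>

definition dominated_by :: "'a measure \<Rightarrow> real \<Rightarrow> 'a measure \<Rightarrow> bool" where
  "dominated_by M c N \<longleftrightarrow> (\<forall>D\<in>sets N. emeasure M D \<le> ennreal c * emeasure N D)"

text \<open>On the set where a Radon-Nikodym density exceeds \<open>c\<close>, domination forces the
  integral of the excess to vanish, so the density is at most \<open>c\<close> almost everywhere.
  Truncation then gives the bounds at every point.\<close>

lemma bounded_density:
  assumes "finite_measure N" and sets: "sets M = sets N" and c: "0 \<le> c"
    and dom: "dominated_by M c N"
  obtains f :: "'a \<Rightarrow> real" where "f \<in> borel_measurable N" "\<And>x. 0 \<le> f x" "\<And>x. f x \<le> c"
    "density N (\<lambda>x. ennreal (f x)) = M"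
proof -
  interpret N: finite_measure N by fact
  have "absolutely_continuous N M"
    using dom sets by (auto simp: absolutely_continuous_def null_sets_def dominated_by_def)
  then obtain h where h [measurable]: "h \<in> borel_measurable N" and dens: "density N h = M"
    using N.Radon_Nikodym[of M] sets by auto
  define S where "S = {x \<in> space N. ennreal c < h x}"
  have S [measurable]: "S \<in> sets N" unfolding S_def by measurable
  have Sle: "(\<integral>\<^sup>+x. h x * indicator S x \<partial>N) \<le> ennreal c * emeasure N S"
    using dom S by (auto simp: dens[symmetric] emeasure_density dominated_by_def)
  have fin: "ennreal c * emeasure N S < \<infinity>"
    using N.emeasure_finite[of S] by (metis ennreal_mult_less_top ennreal_less_top infinity_ennreal_def top.not_eq_extremum)
  \<comment> \<open>The integral of the difference splits because the subtracted integral is finite,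
    \<open>N\<close> being a finite measure.\<close>
  have "(\<integral>\<^sup>+x. (h x * indicator S x - ennreal c * indicator S x) \<partial>N)
      = (\<integral>\<^sup>+x. h x * indicator S x \<partial>N) - (\<integral>\<^sup>+x. ennreal c * indicator S x \<partial>N)"
  proof (rule nn_integral_diff)
    show "(\<integral>\<^sup>+x. ennreal c * indicator S x \<partial>N) \<noteq> \<infinity>"
      using fin by (simp add: nn_integral_cmult_indicator)
    show "AE x in N. ennreal c * indicator S x \<le> h x * indicator S x"
      by (auto simp: S_def indicator_def)
  qed measurable
  also have "\<dots> = 0"
    using Sle fin by (simp add: nn_integral_cmult_indicator diff_eq_0_iff_ennreal)
  finally have "AE x in N. h x * indicator S x - ennreal c * indicator S x = 0"
    by (subst (asm) nn_integral_0_iff_AE) auto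
  then have AE: "AE x in N. h x \<le> ennreal c"
  proof (rule AE_mp, intro AE_I2 impI)
    fix x assume x: "x \<in> space N" and 0: "h x * indicator S x - ennreal c * indicator S x = 0"
    show "h x \<le> ennreal c"
    proof (rule ccontr)
      assume "\<not> h x \<le> ennreal c"
      then have "x \<in> S" "ennreal c < h x" using x by (auto simp: S_def)
      with 0 show False by (auto simp: diff_eq_0_iff_ennreal)
    qed
  qed
  \<comment> \<open>The cut at \<open>c\<close> changes \<open>h\<close> on a null set only and
    makes it real-valued everywhere.\<close>
  define f where "f x = enn2real (min (h x) (ennreal c))" for x
  show thesis
  proof
    show "f \<in> borel_measurable N" unfolding f_def by measurable
    show "0 \<le> f x" for x by (simp add: f_def)
    show "f x \<le> c" for x
      unfolding f_def using c by (intro enn2real_leI) auto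
    have "ennreal (f x) = min (h x) (ennreal c)" for x
      unfolding f_def by (intro ennreal_enn2real) (auto simp: min_less_iff_disj)
    then have "AE x in N. ennreal (f x) = h x"
      using AE by (auto simp: min_def)
    then have "density N (\<lambda>x. ennreal (f x)) = density N h"
      unfolding f_def by (intro density_cong) auto
    then show "density N (\<lambda>x. ennreal (f x)) = M" using dens by simp
  qed
qed

text \<open>Moving \<open>\<rho>\<close> by \<open>s\<close> multiplies its Fourier transform by the
  phase \<open>cis (- 2 * pi * t * s)\<close>. The right-hand side is therefore free of
  \<open>s\<close>: densities of different translates of \<open>\<rho>\<close> have transforms of
  equal modulus.\<close>

lemma cmod_fourier_translate:
  fixes f :: "real \<Rightarrow> real"
  assumes "sets \<mu> = sets borel" "sets \<rho> = sets borel"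
    and f: "f \<in> borel_measurable \<mu>" "\<And>x. 0 \<le> f x"
    and dens: "density \<mu> (\<lambda>x. ennreal (f x)) = distr \<rho> borel (\<lambda>x. x + s)"
  shows "cmod (fourier_fmu \<mu> (\<lambda>x. of_real (f x)) t) = cmod (LINT x|\<rho>. cis (- 2 * pi * t * x))"
proof -
  have [measurable_cong]: "sets \<mu> = sets borel" "sets \<rho> = sets borel" by fact+
  have cis [measurable]: "(\<lambda>x. cis (- (2 * pi * t * x))) \<in> borel_measurable borel"
    by (intro borel_measurable_continuous_onI continuous_intros)
  have "fourier_fmu \<mu> (\<lambda>x. of_real (f x)) t
      = integral\<^sup>L (density \<mu> (\<lambda>x. ennreal (f x))) (\<lambda>x. cis (- 2 * pi * t * x))"
    unfolding fourier_fmu_def using f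
    by (subst integral_density) (auto simp: scaleR_conv_of_real)
  also have "\<dots> = (LINT x|\<rho>. cis (- 2 * pi * t * (x + s)))"
    unfolding dens by (subst integral_distr) auto
  also have "\<dots> = (LINT x|\<rho>. cis (- 2 * pi * t * s) * cis (- 2 * pi * t * x))"
    by (intro Bochner_Integration.integral_cong refl) (simp add: cis_mult algebra_simps)
  also have "\<dots> = cis (- 2 * pi * t * s) * (LINT x|\<rho>. cis (- 2 * pi * t * x))"
    by (rule integral_mult_right_zero)
  finally show ?thesis by (simp add: norm_mult)
qed

text \<open>The two frame inequalities with explicit constants, so that the ratio
  \<open>B / A\<close> can be fixed once before the level \<open>n\<close> varies.\<close>

definition frame_bounds :: "real measure \<Rightarrow> real measure \<Rightarrow> real \<Rightarrow> real \<Rightarrow> bool" where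
  "frame_bounds \<mu> \<nu> A B \<longleftrightarrow> 0 < A \<and> 0 < B \<and>
     (\<forall>f :: real \<Rightarrow> complex. f \<in> borel_measurable \<mu> \<and> integrable \<mu> (\<lambda>x. (cmod (f x))\<^sup>2) \<longrightarrow>
        ennreal A * (\<integral>\<^sup>+ x. ennreal ((cmod (f x))\<^sup>2) \<partial>\<mu>)
          \<le> (\<integral>\<^sup>+ t. ennreal ((cmod (fourier_fmu \<mu> f t))\<^sup>2) \<partial>\<nu>) \<and>
        (\<integral>\<^sup>+ t. ennreal ((cmod (fourier_fmu \<mu> f t))\<^sup>2) \<partial>\<nu>)
          \<le> ennreal B * (\<integral>\<^sup>+ x. ennreal ((cmod (f x))\<^sup>2) \<partial>\<mu>))"

lemma frame_measure_imp_bounds: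
  assumes "frame_measure \<mu> \<nu>"
  obtains A B where "frame_bounds \<mu> \<nu> A B"
  using assms unfolding frame_measure_def frame_bounds_def by blast

text \<open>The L2 norm of a density carrying mass m on E is at least m / sqrt (mu E) by
  Cauchy-Schwarz, while that of a density bounded by c' is at most sqrt (c' m).\<close>
lemma frame_bounds_comparison:
  fixes \<mu> \<nu> \<rho> :: "real measure" and s t c c' :: real
  assumes fr: "frame_bounds \<mu> \<nu> A B" and sm [measurable_cong]: "sets \<mu> = sets borel"
    and "finite_measure \<mu>"
    and s\<rho> [measurable_cong]: "sets \<rho> = sets borel" and fin: "finite_measure \<rho>"
    and c: "0 \<le> c" "0 \<le> c'"
    and dom: "dominated_by (distr \<rho> borel (\<lambda>x. x + s)) c \<mu>"
      "dominated_by (distr \<rho> borel (\<lambda>x. x + t)) c' \<mu>"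
    and E [measurable]: "E \<in> sets borel" and AE: "AE x in \<rho>. x + s \<in> E"
  shows "measure \<rho> UNIV \<le> B / A * c' * measure \<mu> E"
proof -
  interpret finite_measure \<mu> by fact
  interpret \<rho>: finite_measure \<rho> by fact
  from fr have AB: "0 < A" "0 < B"
    and frame: "\<And>f. f \<in> borel_measurable \<mu> \<Longrightarrow> integrable \<mu> (\<lambda>x. (cmod (f x))\<^sup>2) \<Longrightarrow>
           ennreal A * (\<integral>\<^sup>+ x. ennreal ((cmod (f x))\<^sup>2) \<partial>\<mu>)
             \<le> (\<integral>\<^sup>+ t. ennreal ((cmod (fourier_fmu \<mu> f t))\<^sup>2) \<partial>\<nu>) \<and>
           (\<integral>\<^sup>+ t. ennreal ((cmod (fourier_fmu \<mu> f t))\<^sup>2) \<partial>\<nu>)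
             \<le> ennreal B * (\<integral>\<^sup>+ x. ennreal ((cmod (f x))\<^sup>2) \<partial>\<mu>)"
    unfolding frame_bounds_def by blast+
  define m where "m = measure \<rho> UNIV"
  have sp: "space \<rho> = UNIV" "space \<mu> = UNIV"
    using sets_eq_imp_space_eq[OF s\<rho>] sets_eq_imp_space_eq[OF sm] by auto
  obtain f where f [measurable]: "f \<in> borel_measurable \<mu>" and f0: "\<And>x. 0 \<le> f x"
    and fc: "\<And>x. f x \<le> c"
    and fd: "density \<mu> (\<lambda>x. ennreal (f x)) = distr \<rho> borel (\<lambda>x. x + s)"
    using bounded_density[OF \<open>finite_measure \<mu>\<close> _ c(1) dom(1)] sm by auto
  obtain g where g [measurable]: "g \<in> borel_measurable \<mu>" and g0: "\<And>x. 0 \<le> g x"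
    and gc: "\<And>x. g x \<le> c'"
    and gd: "density \<mu> (\<lambda>x. ennreal (g x)) = distr \<rho> borel (\<lambda>x. x + t)"
    using bounded_density[OF \<open>finite_measure \<mu>\<close> _ c(2) dom(2)] sm by auto
  have bint: "integrable \<mu> h" if "h \<in> borel_measurable \<mu>" "\<And>x. 0 \<le> h x" "\<And>x. h x \<le> C"
    for h :: "real \<Rightarrow> real" and C
    using that by (intro integrable_const_bound[of _ C]) auto
  have fi: "integrable \<mu> f" using bint[OF f f0 fc] .
  have gi: "integrable \<mu> g" using bint[OF g g0 gc] .
  have f2i: "integrable \<mu> (\<lambda>x. (f x)\<^sup>2)"
    by (rule bint[of _ "c\<^sup>2"]) (auto intro!: power_mono f0 fc)
  have g2i: "integrable \<mu> (\<lambda>x. (g x)\<^sup>2)"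
    by (rule bint[of _ "c'\<^sup>2"]) (auto intro!: power_mono g0 gc)
  have cm: "cmod (fourier_fmu \<mu> (\<lambda>x. of_real (f x)) u) = cmod (fourier_fmu \<mu> (\<lambda>x. of_real (g x)) u)" for u
    using cmod_fourier_translate[OF sm s\<rho> f f0 fd] cmod_fourier_translate[OF sm s\<rho> g g0 gd] by simp
  \<comment> \<open>The lower frame bound for \<open>f\<close> and the upper one for
    \<open>g\<close> meet at the common integral over \<open>\<nu>\<close>.\<close>
  have "ennreal A * (\<integral>\<^sup>+ x. ennreal ((f x)\<^sup>2) \<partial>\<mu>) \<le> ennreal B * (\<integral>\<^sup>+ x. ennreal ((g x)\<^sup>2) \<partial>\<mu>)"
    using frame[of "\<lambda>x. of_real (f x)"] frame[of "\<lambda>x. of_real (g x)"] f2i g2i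
    by (auto simp: cm)
  then have comp: "A * (LINT x|\<mu>. (f x)\<^sup>2) \<le> B * (LINT x|\<mu>. (g x)\<^sup>2)"
    using f2i g2i AB by (simp add: nn_integral_eq_integral ennreal_mult'[symmetric] ennreal_le_iff)
  have mD: "measure (density \<mu> (\<lambda>x. ennreal (h x))) D = (LINT x|\<mu>. h x * indicator D x)"
    if h[measurable]: "h \<in> borel_measurable \<mu>" and h0: "\<And>x. 0 \<le> h x" and hC: "\<And>x. h x \<le> C" and D[measurable]: "D \<in> sets borel"
    for h C D
  proof -
    have "emeasure (density \<mu> (\<lambda>x. ennreal (h x))) D = (\<integral>\<^sup>+x. ennreal (h x * indicator D x) \<partial>\<mu>)"
      by (subst emeasure_density) (auto intro!: nn_integral_cong simp: indicator_def)
    also have "\<dots> = ennreal (LINT x|\<mu>. h x * indicator D x)"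
      using h0 hC by (intro nn_integral_eq_integral bint[of _ C]) (auto simp: indicator_def intro: order_trans[OF h0 hC])
    finally show ?thesis
      using h0 by (simp add: measure_def integral_nonneg_AE)
  qed
  have "m = measure (distr \<rho> borel (\<lambda>x. x + t)) UNIV"
    by (subst measure_distr) (auto simp: m_def sp)
  also have "\<dots> = (LINT x|\<mu>. g x)"
    unfolding gd[symmetric] using mD[OF g g0 gc, of UNIV] by simp
  finally have mg: "m = (LINT x|\<mu>. g x)" .
  have "m = measure \<rho> ((\<lambda>x. x + s) -` E \<inter> space \<rho>)"
    unfolding m_def using AE measurable_sets[of "\<lambda>x. x + s" \<rho> borel E]
    by (intro \<rho>.finite_measure_eq_AE) (auto simp: sp)
  also have "\<dots> = measure (distr \<rho> borel (\<lambda>x. x + s)) E"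
    by (subst measure_distr) auto
  finally have mE: "m = measure (distr \<rho> borel (\<lambda>x. x + s)) E" .
  have mf: "m = (LINT x|\<mu>. f x * indicator E x)"
    unfolding mE fd[symmetric] by (rule mD[OF f f0 fc E])
  have m0: "0 \<le> m" by (simp add: m_def)
  have up: "(LINT x|\<mu>. (g x)\<^sup>2) \<le> c' * m"
  proof -
    have "(LINT x|\<mu>. (g x)\<^sup>2) \<le> (LINT x|\<mu>. c' * g x)"
      using g2i gi g0 gc by (intro integral_mono) (auto simp: power2_eq_square intro!: mult_right_mono)
    then show ?thesis by (simp add: mg)
  qed
  show "measure \<rho> UNIV \<le> B / A * c' * measure \<mu> E"
  proof (cases "measure \<mu> E = 0")
    \<comment> \<open>Here domination by \<open>c\<close> leaves the copy living on \<open>E\<close>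
      without mass.\<close>
    case True
    have "emeasure (distr \<rho> borel (\<lambda>x. x + s)) E \<le> ennreal c * emeasure \<mu> E"
      using dom(1) E by (auto simp: dominated_by_def sm)
    then have "emeasure (distr \<rho> borel (\<lambda>x. x + s)) E = 0" using True by (simp add: emeasure_eq_measure)
    then have "m = 0" by (simp add: mE measure_def)
    with True show ?thesis by (simp add: m_def)
  next
    case False
    define w where "w = measure \<mu> E"
    have w: "0 < w" using False by (simp add: w_def less_le)
    have fEi: "integrable \<mu> (\<lambda>x. f x * indicator E x)"
      by (rule bint[of _ c]) (auto simp: indicator_def f0 fc c)
    \<comment> \<open>This is the Cauchy-Schwarz inequality by hand: \<open>m / w\<close> is the
      mean of \<open>f\<close> over \<open>E\<close>, so the subtracted function is the projection
      of \<open>f\<close> onto the indicator of \<open>E\<close>.\<close>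
    have "0 \<le> (LINT x|\<mu>. (f x - m / w * indicator E x)\<^sup>2)" by simp
    also have "\<dots> = (LINT x|\<mu>. (f x)\<^sup>2 - 2 * (m / w) * (f x * indicator E x) + (m/w)\<^sup>2 * indicator E x)"
      by (intro Bochner_Integration.integral_cong refl)
         (auto simp: indicator_def power2_eq_square algebra_simps)
    also have "\<dots> = (LINT x|\<mu>. (f x)\<^sup>2) - 2 * (m / w) * m + (m/w)\<^sup>2 * w"
      using f2i fEi by (simp add: mf[symmetric] w_def sp less_top[symmetric])
    also have "\<dots> = (LINT x|\<mu>. (f x)\<^sup>2) - m\<^sup>2 / w"
      using w by (simp add: field_simps power2_eq_square)
    finally have "A * (m\<^sup>2 / w) \<le> A * (LINT x|\<mu>. (f x)\<^sup>2)"
      using AB by (intro mult_left_mono) auto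
    also have "\<dots> \<le> B * (c' * m)" using comp up AB by (meson mult_left_mono order_trans less_imp_le)
    finally have "A * m\<^sup>2 \<le> B * c' * m * w" using w by (simp add: field_simps)
    then have "m * (A * m) \<le> m * (B * c' * w)" by (simp add: power2_eq_square algebra_simps)
    then have "A * m \<le> B * c' * w" if "m > 0" using that by simp
    then have "A * m \<le> B * c' * w"
      using m0 AB c w by (cases "m = 0") auto
    then show ?thesis using AB by (simp add: m_def w_def field_simps)
  qed
qed

section \<open>One-dimensional Hausdorff measure vanishes on Lebesgue null sets\<close>

lemma hausdorff_measure_empty: "hausdorff_measure \<alpha> {} = 0"
proof -
  have "hausdorff_pre \<alpha> \<delta> {} \<le> 0" if "0 < \<delta>" for \<delta>
    unfolding hausdorff_pre_def using that
    by (intro INF_lower2[of "\<lambda>_. {}"]) (auto simp: hd_pow_def)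
  then show ?thesis
    unfolding hausdorff_measure_def by (intro antisym SUP_least) auto
qed

text \<open>A connected set of reals contains the whole interval between any two of its points, so
  its length bounds their distance.\<close>

lemma connected_imp_diameter_le_lborel:
  fixes C :: "real set"
  assumes "connected C" "C \<in> sets borel" "emeasure lborel C < \<infinity>"
  shows "bounded C" "diameter C \<le> measure lborel C"
proof -
  have *: "y - x \<le> measure lborel C" if "x \<in> C" "y \<in> C" "x \<le> y" for x y
  proof -
    have "{x..y} \<subseteq> C"
      using assms(1) that connected_contains_Icc by blast
    then have "measure lborel {x..y} \<le> measure lborel C"
      using assms by (intro measure_mono_fmeasurable) (auto simp: fmeasurable_def)
    then show ?thesis using that by simp
  qed
  have **: "norm (x - y) \<le> measure lborel C" if "x \<in> C" "y \<in> C" for x y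
    using *[of x y] *[of y x] that by (cases "x \<le> y") auto
  show "bounded C"
    unfolding bounded_two_points using ** by (auto simp: dist_norm)
  show "diameter C \<le> measure lborel C"
    by (intro diameter_le **) auto
qed

text \<open>An open cover of small Lebesgue measure splits into countably many disjoint intervals,
  each of them automatically short.\<close>
lemma hausdorff_measure_1_null:
  assumes "A \<in> sets borel" "emeasure lborel A = 0"
  shows "hausdorff_measure 1 A = 0"
proof -
  have small: "hausdorff_pre 1 \<delta> A \<le> ennreal e" if d: "0 < \<delta>" and e0: "0 < e" and ed: "e \<le> \<delta>" for \<delta> e
  proof -
    obtain T where T: "open T" "A \<subseteq> T" "emeasure lborel (T - A) < e"
      using outer_regular_lborel[OF assms(1) e0] by blast
    have [measurable]: "T \<in> sets borel" "A \<in> sets borel" using T(1) assms(1) by auto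
    have "emeasure lborel T \<le> emeasure lborel (A \<union> (T - A))"
      by (intro emeasure_mono) auto
    also have "\<dots> \<le> emeasure lborel A + emeasure lborel (T - A)"
      by (intro emeasure_subadditive) auto
    finally have Te: "emeasure lborel T < e" using T(3) assms(2) by (simp add: le_less_trans)
    define U where "U i = (if i \<in> to_nat_on (components T) ` components T
        then from_nat_into (components T) i else {})" for i
    have cnt: "countable (components T)" 
      using pairwise_disjoint_components[of T] T(1) open_components
      by (intro countable_disjoint_open_subsets) (auto simp: disjnt_def pairwise_def)
    have Ucomp: "U i = {} \<or> U i \<in> components T" for i
      using cnt by (auto simp: U_def)
    have Uopen: "open (U i)" and Uconn: "connected (U i)" and UT: "U i \<subseteq> T" for i
      using Ucomp[of i] open_components[OF T(1)] in_components_connected[of "U i" T]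
        in_components_subset[of "U i" T] by auto
    have Ub [measurable]: "U i \<in> sets borel" for i using Uopen by auto
    have Umeas: "emeasure lborel (U i) \<le> emeasure lborel T" for i
      using UT by (intro emeasure_mono) auto
    have disj: "disjoint_family U"
      unfolding disjoint_family_on_def
    proof (intro ballI impI)
      fix i j :: nat assume "i \<noteq> j"
      show "U i \<inter> U j = {}"
      proof (rule ccontr)
        assume ne: "U i \<inter> U j \<noteq> {}"
        then have i: "i \<in> to_nat_on (components T) ` components T"
          and j: "j \<in> to_nat_on (components T) ` components T" by (auto simp: U_def split: if_splits)
        have "U i = U j"
          using ne Ucomp components_eq by blast
        with i j \<open>i \<noteq> j\<close> cnt show False by (auto simp: U_def)
      qed
    qed
    have cover: "A \<subseteq> (\<Union>i. U i)"
    proof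
      fix x assume "x \<in> A"
      then have "x \<in> \<Union> (components T)" using T(2) by auto
      then obtain C where "C \<in> components T" "x \<in> C" by blast
      then have "x \<in> U (to_nat_on (components T) C)" using cnt by (auto simp: U_def)
      then show "x \<in> (\<Union>i. U i)" by blast
    qed
    have fin: "emeasure lborel (U i) < \<infinity>" for i
      using order.strict_trans[OF le_less_trans[OF Umeas Te] ennreal_less_top] by simp
    have diam: "bounded (U i)" "diameter (U i) \<le> measure lborel (U i)" for i
      using connected_imp_diameter_le_lborel[OF Uconn Ub fin] by auto
    have ml: "measure lborel (U i) \<le> e" for i
      unfolding measure_def using e0 less_imp_le[OF le_less_trans[OF Umeas[of i] Te]]
      by (intro enn2real_leI) auto
    have hd: "ennreal (hd_pow 1 (U i)) \<le> emeasure lborel (U i)" for i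
    proof -
      have "hd_pow 1 (U i) \<le> measure lborel (U i)"
        using diam[of i] diameter_ge_0[OF diam(1)[of i]] by (simp add: hd_pow_def)
      then show ?thesis
        using fin[of i] by (subst emeasure_eq_ennreal_measure) (auto intro: ennreal_leI)
    qed
    have "hausdorff_pre 1 \<delta> A \<le> (\<Sum>i. ennreal (hd_pow 1 (U i)))"
      unfolding hausdorff_pre_def
      by (intro INF_lower CollectI conjI allI cover diam(1) order_trans[OF diam(2) order_trans[OF ml ed]])
    also have "\<dots> \<le> (\<Sum>i. emeasure lborel (U i))" by (intro suminf_le hd) auto
    also have "\<dots> = emeasure lborel (\<Union>i. U i)" by (intro suminf_emeasure disj) auto
    also have "\<dots> \<le> emeasure lborel T" using UT by (intro emeasure_mono) auto
    finally show ?thesis using Te by auto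
  qed
  \<comment> \<open>Taking \<open>min e \<delta>\<close> as the length of the cover keeps every
    diameter below \<open>\<delta>\<close>. The summand 0 matches the shape of
    \<open>ennreal_le_epsilon\<close>.\<close>
  have *: "hausdorff_pre 1 \<delta> A \<le> 0 + ennreal e" if "0 < \<delta>" "0 < e" for \<delta> e
  proof -
    have "hausdorff_pre 1 \<delta> A \<le> ennreal (min e \<delta>)"
      by (intro small) (use that in auto)
    also have "\<dots> \<le> ennreal e" by (intro ennreal_leI) auto
    finally show ?thesis by simp
  qed
  have "hausdorff_pre 1 \<delta> A \<le> 0" if "0 < \<delta>" for \<delta>
    by (rule ennreal_le_epsilon) (rule *[OF that])
  then show ?thesis
    unfolding hausdorff_measure_def by (intro antisym SUP_least) auto
qed

section \<open>Growth rates and averaging over Lebesgue measure\<close>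

text \<open>If \<open>x\<close> were larger, the powers of \<open>x / y\<close> would outgrow
  \<open>C\<close>. Every inequality between weights is obtained by this from estimates at level
  \<open>n\<close> whose constant does not depend on \<open>n\<close>.\<close>

lemma power_le_const_imp_le:
  fixes x y C :: real
  assumes "0 < x" "0 < y" and le: "\<And>n. x ^ n \<le> C * y ^ n"
  shows "x \<le> y"
proof (rule ccontr)
  assume "\<not> x \<le> y"
  then have "1 < x / y" using assms by simp
  then obtain n where "C < (x / y) ^ n" using real_arch_pow by blast
  then have "C * y ^ n < x ^ n" using assms by (simp add: power_divide field_simps)
  with le[of n] show False by simp
qed

text \<open>By Fubini, the mass of the interval of radius \<open>r\<close> around \<open>x\<close>
  integrates over all real \<open>x\<close> to \<open>2 * r\<close>. It cannot exceed twice the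
  resulting mean over \<open>X\<close> at every point of \<open>X\<close>.\<close>

lemma exists_small_interval:
  fixes \<mu> :: "real measure" and X :: "real set"
  assumes mass: "emeasure \<mu> (space \<mu>) = 1" and sm [measurable_cong]: "sets \<mu> = sets borel"
    and X [measurable]: "X \<in> sets borel" and L: "0 < emeasure lborel X" "emeasure lborel X < \<infinity>" and r: "0 < r"
  shows "\<exists>x\<in>X. measure \<mu> {x - r..x + r} \<le> 4 * r / measure lborel X"
proof (rule ccontr)
  interpret finite_measure \<mu> using mass by (intro finite_measureI) simp
  interpret pair_sigma_finite \<mu> lborel ..
  define m where "m = measure lborel X"
  have em: "emeasure lborel X = ennreal m"
    unfolding m_def using L by (intro emeasure_eq_ennreal_measure) auto
  have m: "0 < m" using L em by (auto simp: ennreal_eq_0_iff not_le)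
  assume "\<not> (\<exists>x\<in>X. measure \<mu> {x - r..x + r} \<le> 4 * r / measure lborel X)"
  then have *: "4 * r / m \<le> measure \<mu> {x - r..x + r}" if "x \<in> X" for x
    using that by (force simp: m_def)
  \<comment> \<open>The assumed bound integrates over \<open>X\<close> to \<open>4 * r\<close>,
    while Fubini yields \<open>2 * r\<close>; the slack makes a non-strict bound sufficient.\<close>
  have "ennreal (4 * r) = ennreal (4 * r / m) * emeasure lborel X"
    using m r by (simp add: em ennreal_mult'[symmetric])
  also have "\<dots> = (\<integral>\<^sup>+x. ennreal (4 * r / m) * indicator X x \<partial>lborel)"
    by (simp add: nn_integral_cmult_indicator)
  also have "\<dots> \<le> (\<integral>\<^sup>+x. emeasure \<mu> {x - r..x + r} \<partial>lborel)"
    using * by (intro nn_integral_mono) (auto simp: indicator_def emeasure_eq_measure intro!: ennreal_leI)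
  also have "\<dots> = (\<integral>\<^sup>+x. (\<integral>\<^sup>+y. indicator {z. \<bar>fst z - snd z\<bar> \<le> r} (y, x) \<partial>\<mu>) \<partial>lborel)"
  proof (intro nn_integral_cong)
    fix x
    have "emeasure \<mu> {x - r..x + r} = (\<integral>\<^sup>+y. indicator {x - r..x + r} y \<partial>\<mu>)"
      by (subst nn_integral_indicator) auto
    also have "\<dots> = (\<integral>\<^sup>+y. indicator {z. \<bar>fst z - snd z\<bar> \<le> r} (y, x) \<partial>\<mu>)"
      by (intro nn_integral_cong) (auto simp: indicator_def)
    finally show "emeasure \<mu> {x - r..x + r} = (\<integral>\<^sup>+y. indicator {z. \<bar>fst z - snd z\<bar> \<le> r} (y, x) \<partial>\<mu>)" .
  qed
  also have "\<dots> = (\<integral>\<^sup>+y. (\<integral>\<^sup>+x. indicator {z. \<bar>fst z - snd z\<bar> \<le> r} (y, x) \<partial>lborel) \<partial>\<mu>)"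
    by (rule Fubini) measurable
  also have "\<dots> = (\<integral>\<^sup>+y. ennreal (2 * r) \<partial>\<mu>)"
  proof (intro nn_integral_cong)
    fix y :: real
    have "(\<integral>\<^sup>+x. indicator {z. \<bar>fst z - snd z\<bar> \<le> r} (y, x) \<partial>lborel) = (\<integral>\<^sup>+x. indicator {y - r..y + r} x \<partial>lborel)"
      by (intro nn_integral_cong) (auto simp: indicator_def)
    also have "\<dots> = ennreal (2 * r)" using r by (subst nn_integral_indicator) auto
    finally show "(\<integral>\<^sup>+x. indicator {z. \<bar>fst z - snd z\<bar> \<le> r} (y, x) \<partial>lborel) = ennreal (2 * r)" .
  qed
  also have "\<dots> = ennreal (2 * r)" by (simp add: mass)
  finally show False using r by (simp add: ennreal_le_iff)
qed

text \<open>The average over y in [-1,1] of the measure of the intersection is |G|^2 / 2.\<close>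
lemma exists_scaled_overlap:
  fixes G :: "real set"
  assumes G [measurable]: "G \<in> sets borel" and sub: "G \<subseteq> {0..1}" and L: "0 < measure lborel G"
    and r: "0 \<le> r" "r \<le> 1"
  shows "\<exists>y. (measure lborel G)\<^sup>2 / 4 \<le> measure lborel (G \<inter> {x. r * x + y \<in> G})"
proof (rule ccontr)
  define m where "m = measure lborel G"
  have fin: "emeasure lborel D < \<infinity>" if "D \<subseteq> {0..1::real}" for D
    using emeasure_mono[OF that, of lborel] by (auto intro: le_less_trans)
  have em: "emeasure lborel D = ennreal (measure lborel D)" if "D \<subseteq> {0..1::real}" for D
    using fin[OF that] by (intro emeasure_eq_ennreal_measure) auto
  assume "\<not> (\<exists>y. (measure lborel G)\<^sup>2 / 4 \<le> measure lborel (G \<inter> {x. r * x + y \<in> G}))"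
  then have *: "measure lborel (G \<inter> {x. r * x + y \<in> G}) \<le> m\<^sup>2 / 4" for y
    unfolding m_def by (meson linear)
  let ?h = "\<lambda>x y. indicator {-1..1} y * indicator G x * indicator G (r * x + y) :: ennreal"
  have [measurable]: "case_prod ?h \<in> borel_measurable (lborel \<Otimes>\<^sub>M lborel)"
    by measurable
  have "ennreal (m\<^sup>2) = (\<integral>\<^sup>+x. ennreal m * indicator G x \<partial>lborel)"
    using L sub by (simp add: nn_integral_cmult_indicator em m_def ennreal_mult'[symmetric] power2_eq_square)
  also have "\<dots> = (\<integral>\<^sup>+x. (\<integral>\<^sup>+y. ?h x y \<partial>lborel) \<partial>lborel)"
  proof (intro nn_integral_cong)
    fix x :: real
    show "ennreal m * indicator G x = (\<integral>\<^sup>+y. ?h x y \<partial>lborel)"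
    proof (cases "x \<in> G")
      case True
      then have "0 \<le> x" "x \<le> 1" using sub by auto
      then have rx: "0 \<le> r * x" "r * x \<le> 1" using r by (auto intro: mult_le_one)
      have "(\<integral>\<^sup>+y. ?h x y \<partial>lborel) = (\<integral>\<^sup>+y. indicator G (r * x + 1 * y) \<partial>lborel)"
      proof (intro nn_integral_cong)
        fix y
        \<comment> \<open>Both \<open>r * x\<close> and \<open>r * x + y\<close> lie in [0,1], so
          restricting \<open>y\<close> to [-1,1] loses nothing.\<close>
        have "- 1 \<le> y \<and> y \<le> 1" if "r * x + y \<in> G" using subsetD[OF sub that] rx by auto
        then show "?h x y = indicator G (r * x + 1 * y)" using True by (auto simp: indicator_def)
      qed
      also have "\<dots> = (\<integral>\<^sup>+y. indicator G y \<partial>lborel)"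
        using nn_integral_real_affine[of "indicator G :: real \<Rightarrow> ennreal" 1 "r * x"] by simp
      also have "\<dots> = ennreal m" by (simp add: em sub m_def)
      finally show ?thesis using True by simp
    qed simp
  qed
  also have "\<dots> = (\<integral>\<^sup>+y. (\<integral>\<^sup>+x. ?h x y \<partial>lborel) \<partial>lborel)"
    by (rule lborel_pair.Fubini'[symmetric]) measurable
  \<comment> \<open>The interval [-1,1] has length 2, so the contrary assumption would give
    \<open>m\<^sup>2\<close> at most half of itself.\<close>
  also have "\<dots> \<le> (\<integral>\<^sup>+y. ennreal (m\<^sup>2 / 4) * indicator {-1..1::real} y \<partial>lborel)"
  proof (intro nn_integral_mono)
    fix y :: real
    have "(\<integral>\<^sup>+x. ?h x y \<partial>lborel) = (\<integral>\<^sup>+x. indicator {-1..1} y * indicator (G \<inter> {x. r * x + y \<in> G}) x \<partial>lborel)"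
      by (intro nn_integral_cong) (auto simp: indicator_def)
    also have "\<dots> = indicator {-1..1} y * emeasure lborel (G \<inter> {x. r * x + y \<in> G})"
      by (intro nn_integral_cmult_indicator) measurable
    also have "emeasure lborel (G \<inter> {x. r * x + y \<in> G}) = ennreal (measure lborel (G \<inter> {x. r * x + y \<in> G}))"
      using sub by (intro em) auto
    also have "indicator {-1..1} y * \<dots> \<le> indicator {-1..1} y * ennreal (m\<^sup>2 / 4)"
      by (intro mult_left_mono ennreal_leI *) auto
    finally show "(\<integral>\<^sup>+x. ?h x y \<partial>lborel) \<le> ennreal (m\<^sup>2 / 4) * indicator {-1..1::real} y"
      by (simp add: mult.commute)
  qed
  also have "\<dots> = ennreal (m\<^sup>2 / 4) * ennreal 2"
    by (subst nn_integral_cmult_indicator) auto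
  also have "\<dots> = ennreal (m\<^sup>2 / 4 * 2)"
    by (rule ennreal_mult[symmetric]) auto
  finally show False using L by (simp add: ennreal_le_iff m_def)
qed

text \<open>The sets where the density of \<open>\<mu>\<close> is at least \<open>1 / k\<close>
  exhaust the part of \<open>S\<close> where it is nonzero. Were all of them Lebesgue null,
  \<open>S\<close> would have no mass.\<close>

lemma exists_density_bounded_below:
  fixes \<mu> :: "real measure"
  assumes sm: "sets \<mu> = sets borel" and ac: "absolutely_continuous lborel \<mu>"
    and pos: "0 < emeasure \<mu> S" and S [measurable]: "S \<in> sets borel"
  obtains G M where "G \<in> sets borel" "G \<subseteq> S" "0 < emeasure lborel G" "0 \<le> M"
    "dominated_by (density lborel (indicator G)) M \<mu>"
proof -
  obtain g where g [measurable]: "g \<in> borel_measurable lborel" and dens: "density lborel g = \<mu>"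
    using sigma_finite_measure.Radon_Nikodym[OF lborel.sigma_finite_measure_axioms ac] sm by auto
  \<comment> \<open>Multiplying by \<open>k\<close> instead of dividing makes \<open>G 0\<close>
    empty and puts the points of infinite density into \<open>G 1\<close>.\<close>
  define G where "G k = {x \<in> S. 1 \<le> ennreal (real k) * g x}" for k :: nat
  have [measurable]: "G k \<in> sets borel" for k
  proof -
    have "{x \<in> space lborel. x \<in> S \<and> 1 \<le> ennreal (real k) * g x} \<in> sets lborel" by measurable
    then show ?thesis by (simp add: G_def)
  qed
  have "\<exists>k. 0 < emeasure lborel (G k)"
  proof (rule ccontr)
    assume "\<not> ?thesis"
    then have "(\<Union>k. G k) \<in> null_sets lborel"
      by (intro null_sets_UN) (auto simp: null_sets_def)
    moreover have "{x \<in> S. g x \<noteq> 0} \<subseteq> (\<Union>k. G k)"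
    proof
      fix x assume x: "x \<in> {x \<in> S. g x \<noteq> 0}"
      show "x \<in> (\<Union>k. G k)"
      proof (cases "g x = \<infinity>")
        case True
        then have "x \<in> G 1" using x by (simp add: G_def)
        then show ?thesis by blast
      next
        case False
        then obtain c where c: "g x = ennreal c" "0 < c"
          using x by (cases "g x") (auto simp: less_le)
        obtain k :: nat where "1 < real k * c" using reals_Archimedean3[OF c(2)] by blast
        then have "x \<in> G k" using x c by (simp add: G_def ennreal_mult'[symmetric])
        then show ?thesis by blast
      qed
    qed
    ultimately have "AE x in lborel. x \<notin> {x \<in> S. g x \<noteq> 0}"
      by (intro AE_not_in) (auto intro: null_sets_subset)
    then have "AE x in lborel. g x * indicator S x = 0" by (auto simp: indicator_def)
    then have "(\<integral>\<^sup>+x. g x * indicator S x \<partial>lborel) = 0"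
      by (subst nn_integral_0_iff_AE) auto
    then show False using pos by (simp add: dens[symmetric] emeasure_density)
  qed
  then obtain k where k: "0 < emeasure lborel (G k)" by blast
  show thesis
  proof (rule that[of "G k" "real k"])
    show "dominated_by (density lborel (indicator (G k))) (real k) \<mu>"
      unfolding dominated_by_def
    proof
      fix D assume "D \<in> sets \<mu>"
      then have [measurable]: "D \<in> sets borel" using sm by simp
      have "emeasure (density lborel (indicator (G k))) D
          = (\<integral>\<^sup>+x. indicator (G k) x * indicator D x \<partial>lborel)"
        by (simp add: emeasure_density)
      also have "\<dots> \<le> (\<integral>\<^sup>+x. ennreal (real k) * (g x * indicator D x) \<partial>lborel)"
        by (intro nn_integral_mono) (auto simp: indicator_def G_def)
      also have "\<dots> = ennreal (real k) * emeasure \<mu> D"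
        by (subst nn_integral_cmult) (auto simp: dens[symmetric] emeasure_density)
      finally show "emeasure (density lborel (indicator (G k))) D \<le> ennreal (real k) * emeasure \<mu> D" .
    qed
  qed (use k in \<open>auto simp: G_def\<close>)
qed

section \<open>Self-similar measures and their branches\<close>

text \<open>The attractor and Hausdorff data enter as facts on \<open>X\<close> and as concentration
  of \<open>\<mu>\<close> on \<open>X\<close>. Absolute continuity with respect to Lebesgue measure
  is assumed lemma by lemma, where \<open>\<alpha> = 1\<close> is meant.\<close>

locale self_similar_measure =
  fixes lam :: real and N :: nat and b p :: "nat \<Rightarrow> real" and X :: "real set"
    and \<mu> :: "real measure"
  assumes lam: "0 < lam" "lam < 1"
    and N: "2 \<le> N"
    and b1: "b 1 = 0" and bN: "b N = 1 - lam" and b_mono: "strict_mono_on {1..N} b"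
    and p_pos: "\<And>i. i \<in> {1..N} \<Longrightarrow> 0 < p i"
    and X_sub: "X \<subseteq> {0..1}" and X_borel [measurable]: "X \<in> sets borel"
    and X_eq: "X = (\<Union>i \<in> {1..N}. (\<lambda>x. lam * x + b i) ` X)"
    and sets_\<mu> [measurable_cong]: "sets \<mu> = sets borel"
    and mass: "emeasure \<mu> (space \<mu>) = 1"
    and invariant: "\<And>D. D \<in> sets borel \<Longrightarrow> emeasure \<mu> D =
         (\<Sum>i = 1..N. ennreal (p i) * emeasure \<mu> ((\<lambda>x. lam * x + b i) -` D))"
    and support: "AE x in \<mu>. x \<in> X"
begin

sublocale finite_measure \<mu>
  using mass by (intro finite_measureI) simp

lemma space_\<mu>: "space \<mu> = UNIV"
  using sets_eq_imp_space_eq[OF sets_\<mu>] by simp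

lemma measure_le_1: "measure \<mu> D \<le> 1"
  using bounded_measure[of D] mass by (simp add: measure_def)

lemma measure_UNIV: "measure \<mu> UNIV = 1"
  using mass by (simp add: measure_def space_\<mu>)

lemma branch_le:
  assumes "i \<in> {1..N}" "D \<in> sets borel"
  shows "ennreal (p i) * emeasure \<mu> ((\<lambda>x. lam * x + b i) -` D) \<le> emeasure \<mu> D"
  unfolding invariant[OF assms(2)] using assms(1)
  by (intro member_le_sum) auto

text \<open>Keeping one summand of the invariance equation shows that applying branch
  \<open>i\<close> costs a factor \<open>1 / p i\<close> in the density. The map \<open>h\<close>
  stands for the branches already applied.\<close>

lemma dominated_by_branch:
  assumes i: "i \<in> {1..N}" and c: "0 \<le> c" and s\<rho> [measurable_cong]: "sets \<rho> = sets borel"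
    and h [measurable]: "h \<in> borel_measurable borel"
    and dom: "dominated_by (distr \<rho> borel h) c \<mu>"
  shows "dominated_by (distr \<rho> borel (\<lambda>x. lam * h x + b i)) (c / p i) \<mu>"
  unfolding dominated_by_def
proof
  fix D assume "D \<in> sets \<mu>"
  then have D [measurable]: "D \<in> sets borel" by (simp add: sets_\<mu>)
  have pre: "(\<lambda>x. lam * x + b i) -` D \<in> sets borel"
    using measurable_sets[of "\<lambda>x. lam * x + b i" borel borel D] by simp
  have "emeasure (distr \<rho> borel (\<lambda>x. lam * h x + b i)) D
      = emeasure (distr \<rho> borel h) ((\<lambda>x. lam * x + b i) -` D)"
    using pre by (simp add: emeasure_distr vimage_def)
  also have "\<dots> \<le> ennreal c * emeasure \<mu> ((\<lambda>x. lam * x + b i) -` D)"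
    using dom pre by (auto simp: dominated_by_def sets_\<mu>)
  also have "\<dots> = ennreal (c / p i) * (ennreal (p i) * emeasure \<mu> ((\<lambda>x. lam * x + b i) -` D))"
    using p_pos[OF i] c by (simp add: mult.assoc[symmetric] ennreal_mult'[symmetric])
  also have "\<dots> \<le> ennreal (c / p i) * emeasure \<mu> D"
    by (intro mult_left_mono branch_le i D) auto
  finally show "emeasure (distr \<rho> borel (\<lambda>x. lam * h x + b i)) D \<le> ennreal (c / p i) * emeasure \<mu> D" .
qed

text \<open>The fixed point of branch \<open>i\<close>. With it the \<open>n\<close>-fold iterate of
  that branch is \<open>lam ^ n * x + (1 - lam ^ n) * fixpt i\<close>, without a geometric
  sum.\<close>

definition fixpt :: "nat \<Rightarrow> real" where "fixpt i = b i / (1 - lam)"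

lemma fixpt_eq: "lam * fixpt i + b i = fixpt i"
  using lam by (simp add: fixpt_def field_simps)

lemma fixpt_ends: "fixpt (Suc 0) = 0" "fixpt N = 1"
  using lam b1 bN by (auto simp: fixpt_def)

text \<open>Each of the \<open>n\<close> applications of branch \<open>i\<close> costs a factor
  \<open>1 / p i\<close>. The measure is left general, since both \<open>\<mu>\<close> and a
  restriction of Lebesgue measure are inserted later.\<close>

lemma dominated_by_branch_power:
  assumes i: "i \<in> {1..N}" and c: "0 \<le> c" and s\<rho> [measurable_cong]: "sets \<rho> = sets borel"
    and dom: "dominated_by \<rho> c \<mu>"
  shows "dominated_by (distr \<rho> borel (\<lambda>x. lam ^ n * x + (1 - lam ^ n) * fixpt i)) (c / p i ^ n) \<mu>"
proof (induction n)
  case 0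
  have "distr \<rho> borel (\<lambda>x. x) = \<rho>"
    using s\<rho> by (rule distr_id2[OF sym])
  with dom show ?case by simp
next
  case (Suc n)
  have "lam * (lam ^ n * x + (1 - lam ^ n) * fixpt i) + b i
      = lam ^ Suc n * x + (1 - lam ^ Suc n) * fixpt i" for x
    using fixpt_eq[of i] by (simp add: algebra_simps)
  moreover have "c / p i ^ n / p i = c / p i ^ Suc n" by simp
  moreover have "0 \<le> c / p i ^ n" using c p_pos[OF i] by simp
  ultimately show ?case
    using dominated_by_branch[OF i _ s\<rho> _ Suc] by (simp only:) simp
qed

lemma dominated_by_self: "dominated_by \<mu> 1 \<mu>"
  by (simp add: dominated_by_def)

text \<open>Unrolling \<open>X_eq\<close> \<open>n\<close> times gives an address of
  \<open>x\<close>. No size is recorded for \<open>c\<close>, because the constant of the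
  concentrated copy does not appear in the conclusion of
  \<open>frame_bounds_comparison\<close>.\<close>

lemma piece_containing:
  assumes "x \<in> X"
  shows "\<exists>s c y. y \<in> X \<and> 0 \<le> c \<and> x = lam ^ n * y + s \<and>
    dominated_by (distr \<mu> borel (\<lambda>z. lam ^ n * z + s)) c \<mu>"
  using assms
proof (induction n arbitrary: x)
  case 0
  have "distr \<mu> borel (\<lambda>x. x) = \<mu>"
    using sets_\<mu> by (rule distr_id2[OF sym])
  with 0 dominated_by_self show ?case
    by (intro exI[of _ 0] exI[of _ 1] exI[of _ x]) auto
next
  case (Suc n)
  from Suc.prems obtain i x' where i: "i \<in> {1..N}" and x': "x' \<in> X" "x = lam * x' + b i"
    by (subst (asm) X_eq) auto
  from Suc.IH[OF x'(1)] obtain s c y where *: "y \<in> X" "0 \<le> c" "x' = lam ^ n * y + s"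
    "dominated_by (distr \<mu> borel (\<lambda>z. lam ^ n * z + s)) c \<mu>" by blast
  have eq: "lam * (lam ^ n * z + s) + b i = lam ^ Suc n * z + (lam * s + b i)" for z
    by (simp add: algebra_simps)
  have "dominated_by (distr \<mu> borel (\<lambda>z. lam ^ Suc n * z + (lam * s + b i))) (c / p i) \<mu>"
    unfolding eq[symmetric] by (intro dominated_by_branch i * sets_\<mu>) measurable
  moreover have "0 \<le> c / p i" using *(2) p_pos[OF i] by simp
  moreover have "x = lam ^ Suc n * y + (lam * s + b i)" using x'(2) *(3) eq by simp
  ultimately show ?case using *(1) by blast
qed

text \<open>The image of [0,1] under the \<open>n\<close>-fold iterate of branch
  \<open>i\<close>.\<close>

definition end_piece :: "nat \<Rightarrow> nat \<Rightarrow> real set" where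
  "end_piece i n = {(1 - lam ^ n) * fixpt i .. (1 - lam ^ n) * fixpt i + lam ^ n}"

text \<open>Only the branch i itself charges a small piece around its fixed point when that is
  an endpoint of [0,1].\<close>
lemma end_piece_measure_le:
  assumes i: "i = 1 \<or> i = N"
  obtains C where "0 < C" "\<And>n. measure \<mu> (end_piece i n) \<le> C * p i ^ n"
proof -
  have iN: "i \<in> {1..N}" using i N by auto
  note pi = p_pos[OF iN]
  define d where "d = Min ((\<lambda>k. \<bar>b k - b i\<bar>) ` ({1..N} - {i}))"
  have ne: "{1..N} - {i} \<noteq> {}"
  proof -
    have "(if i = 1 then N else 1) \<in> {1..N} - {i}" using i N by auto
    then show ?thesis by blast
  qed
  have "b k \<noteq> b i" if "k \<in> {1..N} - {i}" for k
    using inj_on_eq_iff[OF strict_mono_on_imp_inj_on[OF b_mono], of k i] that iN by simp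
  then have d: "0 < d"
    unfolding d_def using ne by (subst Min_gr_iff) auto
  have dle: "d \<le> \<bar>b k - b i\<bar>" if "k \<in> {1..N} - {i}" for k
    unfolding d_def using that by (intro Min_le) auto
  \<comment> \<open>From level \<open>n0\<close> on, an end piece is shorter than the least gap
    \<open>d\<close> between \<open>b i\<close> and the other translations.\<close>
  obtain n0 where n0: "lam ^ n0 < d"
    using real_arch_pow_inv[OF d lam(2)] by blast
  have rec: "measure \<mu> (end_piece i (Suc n)) = p i * measure \<mu> (end_piece i n)" if "n0 \<le> Suc n" for n
  proof -
    have small: "lam ^ Suc n < d"
      using n0 power_decreasing[OF that, of lam] lam by simp
    \<comment> \<open>Branch \<open>k\<close> sends [0,1] to points at distance at least
      \<open>d\<close> from the end point: values are at least \<open>d\<close> when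
      \<open>i = 1\<close> and at most \<open>1 - d\<close> when \<open>i = N\<close>.\<close>
    have zero: "emeasure \<mu> ((\<lambda>x. lam * x + b k) -` end_piece i (Suc n)) = 0" if k: "k \<in> {1..N} - {i}" for k
    proof -
      have "lam * x + b k \<notin> end_piece i (Suc n)" if "x \<in> X" for x
      proof -
        have x: "0 \<le> x" "x \<le> 1" using that X_sub by auto
        then have lx: "0 \<le> lam * x" "lam * x \<le> lam" using lam by (auto simp: mult_left_le)
        have mono: "b 1 \<le> b k" "b k \<le> b N"
          using k N strict_mono_on_imp_mono_on[OF b_mono] by (auto simp: mono_on_def)
        show ?thesis
          using i
        proof
          assume "i = 1"
          then show ?thesis using dle[OF k] small mono lx b1 fixpt_ends
            by (auto simp: end_piece_def)
        next
          assume "i = N"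
          then show ?thesis using dle[OF k] small mono lx bN fixpt_ends
            by (auto simp: end_piece_def)
        qed
      qed
      then have "AE x in \<mu>. x \<notin> (\<lambda>x. lam * x + b k) -` end_piece i (Suc n)"
        using support by (auto elim: AE_mp)
      moreover have "(\<lambda>x. lam * x + b k) -` end_piece i (Suc n) \<in> sets \<mu>"
        using measurable_sets[of "\<lambda>x. lam * x + b k" borel borel "end_piece i (Suc n)"]
        by (simp add: sets_\<mu> end_piece_def)
      ultimately show ?thesis
        using AE_iff_measurable[of "(\<lambda>x. lam * x + b k) -` end_piece i (Suc n)" \<mu>
            "\<lambda>x. x \<notin> (\<lambda>x. lam * x + b k) -` end_piece i (Suc n)"] by (auto simp: space_\<mu>)
    qed
    have pre: "(\<lambda>x. lam * x + b i) -` end_piece i (Suc n) = end_piece i n"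
    proof -
      have "lam * x + b i = lam * (x - (1 - lam ^ n) * fixpt i) + (1 - lam ^ Suc n) * fixpt i" for x
        using fixpt_eq[of i] by (simp add: algebra_simps)
      then show ?thesis using lam by (auto simp: end_piece_def zero_le_mult_iff)
    qed
    have "emeasure \<mu> (end_piece i (Suc n)) = ennreal (p i) * emeasure \<mu> (end_piece i n)"
    proof -
      have "emeasure \<mu> (end_piece i (Suc n))
          = (\<Sum>k = 1..N. ennreal (p k) * emeasure \<mu> ((\<lambda>x. lam * x + b k) -` end_piece i (Suc n)))"
        by (rule invariant) (simp add: end_piece_def)
      also have "\<dots> = ennreal (p i) * emeasure \<mu> ((\<lambda>x. lam * x + b i) -` end_piece i (Suc n))"
        by (subst sum.remove[OF _ iN]) (simp_all add: zero)
      finally show ?thesis by (simp only: pre)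
    qed
    then show ?thesis
      using pi by (simp add: measure_def enn2real_mult)
  qed
  show thesis
  \<comment> \<open>This constant makes the bound at least 1 up to level \<open>n0\<close>, where
    total mass 1 suffices; from there on \<open>rec\<close> contributes a factor \<open>p i\<close>
    per level.\<close>
  proof (rule that[of "1 / p i ^ n0"])
    fix n
    have low: "1 \<le> 1 / p i ^ n0 * p i ^ n" if "n \<le> n0" for n
    proof -
      have "p i \<le> 1"
      proof -
        have "ennreal (p i) * emeasure \<mu> ((\<lambda>x. lam * x + b i) -` UNIV) \<le> emeasure \<mu> UNIV"
          using iN by (intro branch_le) auto
        then show ?thesis using mass by (simp add: space_\<mu>)
      qed
      then show ?thesis using pi power_decreasing[OF that, of "p i"] by simp
    qed
    show "measure \<mu> (end_piece i n) \<le> 1 / p i ^ n0 * p i ^ n"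
    proof (induction n)
      case 0
      show ?case using low[of 0] measure_le_1[of "end_piece i 0"] by simp
    next
      case (Suc n)
      show ?case
      proof (cases "n0 \<le> Suc n")
        case True
        then show ?thesis using rec[OF True] mult_left_mono[OF Suc, of "p i"] pi by (simp add: mult_ac)
      next
        case False
        then show ?thesis using low[of "Suc n"] measure_le_1[of "end_piece i (Suc n)"] by simp
      qed
    qed
  qed (use pi in auto)
qed

lemma distr_shift:
  fixes r s :: real
  assumes [measurable_cong]: "sets \<rho> = sets borel"
  shows "distr (distr \<rho> borel (\<lambda>x. r * x)) borel (\<lambda>x. x + s) = distr \<rho> borel (\<lambda>x. r * x + s)"
  by (subst distr_distr) (auto simp: comp_def)

text \<open>Affine images of \<open>\<rho>\<close> with the same ratio \<open>r\<close> are
  translates of the single measure \<open>\<rho>\<close> scaled by \<open>r\<close>.\<close>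

lemma scaled_comparison:
  fixes \<rho> :: "real measure" and r s t c c' :: real
  assumes fr: "frame_bounds \<mu> \<nu> A B"
    and s\<rho> [measurable_cong]: "sets \<rho> = sets borel" and fin: "finite_measure \<rho>"
    and c: "0 \<le> c" "0 \<le> c'"
    and dom: "dominated_by (distr \<rho> borel (\<lambda>x. r * x + s)) c \<mu>"
      "dominated_by (distr \<rho> borel (\<lambda>x. r * x + t)) c' \<mu>"
    and E [measurable]: "E \<in> sets borel" and AE: "AE x in \<rho>. r * x + s \<in> E"
  shows "measure \<rho> UNIV \<le> B / A * c' * measure \<mu> E"
proof -
  let ?\<rho> = "distr \<rho> borel (\<lambda>x. r * x)"
  have "measure \<rho> UNIV = measure ?\<rho> UNIV"
    using sets_eq_imp_space_eq[OF s\<rho>] by (subst measure_distr) auto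
  also have "\<dots> \<le> B / A * c' * measure \<mu> E"
  proof (rule frame_bounds_comparison[OF fr sets_\<mu> finite_measure_axioms _ _ c])
    show "finite_measure ?\<rho>" by (intro finite_measure.finite_measure_distr fin) auto
    show "AE x in ?\<rho>. x + s \<in> E" using AE by (subst AE_distr_iff) auto
  qed (use dom E in \<open>auto simp: distr_shift[OF s\<rho>]\<close>)
  finally show ?thesis .
qed

section \<open>Comparing all weights with the end weights\<close>

text \<open>The iterate of branch \<open>i\<close> supplies the concentrated copy of
  \<open>\<mu>\<close>, that of branch \<open>j\<close> the copy of bounded density. The comparison
  reads \<open>1 \<le> K / p j ^ n * C * p i ^ n\<close>.\<close>

lemma weight_le_end_weight:
  assumes fr: "frame_measure \<mu> \<nu>" and i: "i = 1 \<or> i = N" and j: "j \<in> {1..N}"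
  shows "p j \<le> p i"
proof -
  have iN: "i \<in> {1..N}" using i N by auto
  obtain A B where AB: "frame_bounds \<mu> \<nu> A B"
    using frame_measure_imp_bounds[OF fr] .
  then have "0 < A" "0 < B" by (auto simp: frame_bounds_def)
  define K where "K = B / A"
  have K: "0 < K" using \<open>0 < A\<close> \<open>0 < B\<close> by (simp add: K_def)
  note comp = scaled_comparison[OF AB, folded K_def]
  obtain C where C: "0 < C" and dec: "\<And>n. measure \<mu> (end_piece i n) \<le> C * p i ^ n"
    using end_piece_measure_le[OF i] by metis
  show ?thesis
  proof (rule power_le_const_imp_le[of _ _ "K * C"])
    fix n
    have "AE x in \<mu>. lam ^ n * x + (1 - lam ^ n) * fixpt i \<in> end_piece i n"
      using support
    proof eventually_elim
      case (elim x)
      then have "0 \<le> x" "x \<le> 1" using X_sub by auto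
      then show ?case using lam by (auto simp: end_piece_def mult_left_le)
    qed
    then have "measure \<mu> UNIV \<le> K * (1 / p j ^ n) * measure \<mu> (end_piece i n)"
      using p_pos[OF j] p_pos[OF iN]
      by (intro comp[OF sets_\<mu> finite_measure_axioms _ _
          dominated_by_branch_power[OF iN _ sets_\<mu> dominated_by_self]
          dominated_by_branch_power[OF j _ sets_\<mu> dominated_by_self]]) (auto simp: end_piece_def)
    also have "\<dots> \<le> K * (1 / p j ^ n) * (C * p i ^ n)"
      using dec K p_pos[OF j] by (intro mult_left_mono) auto
    finally show "p j ^ n \<le> K * C * p i ^ n"
      using p_pos[OF j] by (simp add: measure_UNIV field_simps)
  qed (use p_pos i j N iN in auto)
qed

lemma end_weights_eq:
  assumes "frame_measure \<mu> \<nu>"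
  shows "p 1 = p N"
  using weight_le_end_weight[OF assms, of 1 N] weight_le_end_weight[OF assms, of N 1] N by auto

section \<open>Weights under Lebesgue absolute continuity\<close>

lemma emeasure_X: "emeasure \<mu> X = 1"
proof -
  have "emeasure \<mu> X = emeasure \<mu> (space \<mu>)"
    using support by (intro emeasure_eq_AE) (auto simp: space_\<mu>)
  then show ?thesis using mass by simp
qed

lemma lebesgue_X_pos:
  assumes "absolutely_continuous lborel \<mu>"
  shows "0 < emeasure lborel X" "emeasure lborel X < \<infinity>"
proof -
  have "X \<notin> null_sets lborel"
    using assms emeasure_X by (auto simp: absolutely_continuous_def dest!: subsetD[of "null_sets lborel" _ X])
  then show "0 < emeasure lborel X"
    by (auto simp: null_sets_def zero_less_iff_neq_zero)
  show "emeasure lborel X < \<infinity>"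
    using emeasure_mono[OF X_sub, of lborel] by (auto intro: le_less_trans)
qed

text \<open>The concentrated copy is now a piece of level \<open>n\<close> through a point of
  \<open>X\<close> around which \<open>\<mu>\<close> has mass of order \<open>lam ^ n\<close>.
  Branch \<open>j\<close> again gives the copy of density at most
  \<open>1 / p j ^ n\<close>.\<close>

lemma weight_le_ratio:
  assumes fr: "frame_measure \<mu> \<nu>" and ac: "absolutely_continuous lborel \<mu>" and j: "j \<in> {1..N}"
  shows "p j \<le> lam"
proof -
  obtain A B where AB: "frame_bounds \<mu> \<nu> A B"
    using frame_measure_imp_bounds[OF fr] .
  then have "0 < A" "0 < B" by (auto simp: frame_bounds_def)
  define K where "K = B / A"
  have K: "0 < K" using \<open>0 < A\<close> \<open>0 < B\<close> by (simp add: K_def)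
  note comp = scaled_comparison[OF AB, folded K_def]
  have LX: "0 < measure lborel X"
    using lebesgue_X_pos[OF ac] by (simp add: measure_def enn2real_positive_iff)
  show ?thesis
  proof (rule power_le_const_imp_le[of _ _ "K * (4 / measure lborel X)"])
    fix n
    obtain x where x: "x \<in> X"
      and mx: "measure \<mu> {x - lam ^ n..x + lam ^ n} \<le> 4 * lam ^ n / measure lborel X"
      using exists_small_interval[OF mass sets_\<mu> X_borel lebesgue_X_pos[OF ac], of "lam ^ n"] lam by auto
    obtain s c y where y: "y \<in> X" "0 \<le> c" "x = lam ^ n * y + s"
      and dom: "dominated_by (distr \<mu> borel (\<lambda>z. lam ^ n * z + s)) c \<mu>"
      using piece_containing[OF x] by blast
    \<comment> \<open>The point \<open>x\<close> is the image of \<open>y\<close> in the same piece,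
      whose diameter is at most \<open>lam ^ n\<close>.\<close>
    have "AE z in \<mu>. lam ^ n * z + s \<in> {x - lam ^ n..x + lam ^ n}"
      using support
    proof eventually_elim
      case (elim z)
      then have "z \<in> {0..1}" "y \<in> {0..1}" using X_sub y(1) by auto
      then have "\<bar>z - y\<bar> \<le> 1" by auto
      then have "\<bar>lam ^ n * (z - y)\<bar> \<le> lam ^ n" using lam by (simp add: abs_mult mult_left_le)
      then show ?case using y(3) by (auto simp: algebra_simps abs_le_iff)
    qed
    then have "measure \<mu> UNIV \<le> K * (1 / p j ^ n) * measure \<mu> {x - lam ^ n..x + lam ^ n}"
      using p_pos[OF j]
      by (intro comp[OF sets_\<mu> finite_measure_axioms y(2) _ dom
          dominated_by_branch_power[OF j _ sets_\<mu> dominated_by_self]]) auto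
    also have "\<dots> \<le> K * (1 / p j ^ n) * (4 * lam ^ n / measure lborel X)"
      using mx K p_pos[OF j] by (intro mult_left_mono) auto
    finally show "p j ^ n \<le> K * (4 / measure lborel X) * lam ^ n"
      using p_pos[OF j] LX by (simp add: measure_UNIV field_simps)
  qed (use p_pos j lam in auto)
qed

text \<open>A copy of Lebesgue measure on part of G, shrunk by lam^n, sits both at the left end,
  which mu charges by O(p 1 ^ n), and inside G, where its density is O(lam^(-n)).\<close>
lemma ratio_le_end_weight:
  assumes fr: "frame_measure \<mu> \<nu>" and ac: "absolutely_continuous lborel \<mu>"
  shows "lam \<le> p 1"
proof -
  have N1: "1 \<in> {1..N}" using N by auto
  obtain A B where AB: "frame_bounds \<mu> \<nu> A B"
    using frame_measure_imp_bounds[OF fr] .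
  then have "0 < A" "0 < B" by (auto simp: frame_bounds_def)
  define K where "K = B / A"
  have K: "0 < K" using \<open>0 < A\<close> \<open>0 < B\<close> by (simp add: K_def)
  note comp = scaled_comparison[OF AB, folded K_def]
  obtain C where C: "0 < C" and dec: "\<And>n. measure \<mu> (end_piece 1 n) \<le> C * p 1 ^ n"
    using end_piece_measure_le[of 1] by metis
  have "0 < emeasure \<mu> X" by (simp add: emeasure_X)
  then obtain G M where G [measurable]: "G \<in> sets borel" and GX: "G \<subseteq> X" and Gpos: "0 < emeasure lborel G"
    and M: "0 \<le> M" and domG: "dominated_by (density lborel (indicator G)) M \<mu>"
    using exists_density_bounded_below[OF sets_\<mu> ac _ X_borel] by metis
  have Gsub: "G \<subseteq> {0..1}" using GX X_sub by blast
  have Gfin: "emeasure lborel G < \<infinity>"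
    using emeasure_mono[OF Gsub, of lborel] by (auto intro: le_less_trans)
  have GD: "emeasure lborel (G \<inter> D) \<le> ennreal M * emeasure \<mu> D" if [measurable]: "D \<in> sets borel" for D
    using domG that by (auto simp: dominated_by_def sets_\<mu> emeasure_density indicator_inter_arith[symmetric])
  \<comment> \<open>A lower bound, the same for all \<open>n\<close>, for the mass of the set
    \<open>P\<close> chosen below.\<close>
  define g where "g = (measure lborel G)\<^sup>2 / 4"
  have mG: "0 < measure lborel G"
    using Gpos Gfin by (simp add: measure_def enn2real_positive_iff)
  then have g: "0 < g" by (simp add: g_def)
  show ?thesis
  proof (rule power_le_const_imp_le[of _ _ "K * M * C / g"])
    fix n
    obtain y where y: "g \<le> measure lborel (G \<inter> {x. lam ^ n * x + y \<in> G})"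
      using exists_scaled_overlap[OF G Gsub mG, of "lam ^ n"] lam unfolding g_def
      by (auto simp: power_le_one)
    \<comment> \<open>Points of \<open>G\<close> that the map \<open>lam ^ n * x + y\<close> keeps
      in \<open>G\<close>, so that \<open>M\<close> controls both Lebesgue measure on
      \<open>P\<close> and its shrunken image.\<close>
    define P where "P = G \<inter> {x. lam ^ n * x + y \<in> G}"
    have [measurable]: "P \<in> sets borel" unfolding P_def by measurable
    define \<rho> where "\<rho> = density lborel (indicator P :: real \<Rightarrow> ennreal)"
    have s\<rho> [measurable_cong]: "sets \<rho> = sets borel" by (simp add: \<rho>_def)
    have em\<rho>: "emeasure \<rho> D = emeasure lborel (P \<inter> D)" if [measurable]: "D \<in> sets borel" for D
      by (simp add: \<rho>_def emeasure_density indicator_inter_arith[symmetric])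
    have "emeasure lborel P \<le> emeasure lborel G" unfolding P_def by (intro emeasure_mono) auto
    then have fin: "finite_measure \<rho>"
      using Gfin em\<rho>[of UNIV] by (intro finite_measureI) (auto simp: \<rho>_def)
    have dom\<rho>: "dominated_by \<rho> M \<mu>"
      unfolding dominated_by_def
    proof
      fix D assume "D \<in> sets \<mu>"
      then have [measurable]: "D \<in> sets borel" by (simp add: sets_\<mu>)
      have "emeasure \<rho> D \<le> emeasure lborel (G \<inter> D)"
        unfolding em\<rho>[OF \<open>D \<in> sets borel\<close>] by (intro emeasure_mono) (auto simp: P_def)
      also have "\<dots> \<le> ennreal M * emeasure \<mu> D" by (intro GD) auto
      finally show "emeasure \<rho> D \<le> ennreal M * emeasure \<mu> D" .
    qed
    have dom1: "dominated_by (distr \<rho> borel (\<lambda>x. lam ^ n * x + 0)) (M / p 1 ^ n) \<mu>"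
      using dominated_by_branch_power[OF N1 M s\<rho> dom\<rho>, of n] by (simp add: fixpt_ends)
    have dom2: "dominated_by (distr \<rho> borel (\<lambda>x. lam ^ n * x + y)) (M / lam ^ n) \<mu>"
      unfolding dominated_by_def
    proof
      fix D assume "D \<in> sets \<mu>"
      then have D [measurable]: "D \<in> sets borel" by (simp add: sets_\<mu>)
      have ln: "0 < lam ^ n" using lam by simp
      have pre: "(\<lambda>x. lam ^ n * x + y) -` D \<in> sets borel"
        using measurable_sets[of "\<lambda>x. lam ^ n * x + y" borel borel D] by simp
      have "emeasure (distr \<rho> borel (\<lambda>x. lam ^ n * x + y)) D = emeasure lborel (P \<inter> (\<lambda>x. lam ^ n * x + y) -` D)"
        using pre by (simp add: emeasure_distr em\<rho>[OF pre] sets_eq_imp_space_eq[OF s\<rho>])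
      also have "\<dots> = (\<integral>\<^sup>+x. indicator (P \<inter> (\<lambda>x. lam ^ n * x + y) -` D) x \<partial>lborel)"
        using pre by (subst nn_integral_indicator) auto
      also have "\<dots> \<le> (\<integral>\<^sup>+x. indicator (G \<inter> D) (y + lam ^ n * x) \<partial>lborel)"
        by (intro nn_integral_mono) (auto simp: indicator_def P_def add.commute)
      \<comment> \<open>The affine change of variables carries the factor \<open>lam ^ n\<close> on
        the side of the integral; it is multiplied in here and cancelled at the end.\<close>
      finally have "ennreal (lam ^ n) * emeasure (distr \<rho> borel (\<lambda>x. lam ^ n * x + y)) D
          \<le> ennreal (lam ^ n) * (\<integral>\<^sup>+x. indicator (G \<inter> D) (y + lam ^ n * x) \<partial>lborel)"
        by (intro mult_left_mono) auto
      also have "\<dots> = emeasure lborel (G \<inter> D)"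
        using nn_integral_real_affine[of "indicator (G \<inter> D) :: real \<Rightarrow> ennreal" "lam ^ n" y, symmetric] lam
        by simp
      also have "\<dots> \<le> ennreal M * emeasure \<mu> D" by (intro GD) auto
      finally have "ennreal (1 / lam ^ n) * (ennreal (lam ^ n) * emeasure (distr \<rho> borel (\<lambda>x. lam ^ n * x + y)) D)
          \<le> ennreal (1 / lam ^ n) * (ennreal M * emeasure \<mu> D)"
        by (intro mult_left_mono) auto
      then show "emeasure (distr \<rho> borel (\<lambda>x. lam ^ n * x + y)) D \<le> ennreal (M / lam ^ n) * emeasure \<mu> D"
        using ln M lam by (simp add: mult.assoc[symmetric] ennreal_mult'[symmetric])
    qed
    have "AE x in \<rho>. x \<in> P"
      unfolding \<rho>_def by (subst AE_density) (auto simp: indicator_def)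
    then have AE: "AE x in \<rho>. lam ^ n * x + 0 \<in> end_piece 1 n"
    proof eventually_elim
      case (elim x)
      then have "0 \<le> x" "x \<le> 1" using Gsub by (auto simp: P_def)
      then show ?case using lam by (auto simp: end_piece_def fixpt_ends mult_left_le)
    qed
    have "g \<le> measure \<rho> UNIV"
      using y by (simp add: measure_def em\<rho> P_def)
    also have "\<dots> \<le> K * (M / lam ^ n) * measure \<mu> (end_piece 1 n)"
      using M p_pos[OF N1] lam by (intro comp[OF s\<rho> fin _ _ dom1 dom2 _ AE]) (auto simp: end_piece_def)
    also have "\<dots> \<le> K * (M / lam ^ n) * (C * p 1 ^ n)"
      using dec K M lam by (intro mult_left_mono) auto
    finally show "lam ^ n \<le> K * M * C / g * p 1 ^ n"
      using lam g by (simp add: field_simps)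
  qed (use p_pos N1 lam in auto)
qed

end

section \<open>From the attractor and Hausdorff measure to the locale\<close>

theorem theorem4p1:
  fixes lam \<alpha> :: real and N :: nat and b p :: "nat \<Rightarrow> real"
    and X :: "real set" and \<mu> :: "real measure"
  assumes lam: "0 < lam" "lam < 1"
    and N: "1 \<le> N"
    and b: "b 1 = 0" "b N = 1 - lam" "\<forall>i \<in> {1..<N}. b i < b (Suc i)"
    and p: "\<forall>i \<in> {1..N}. 0 < p i" "(\<Sum>i = 1..N. p i) = 1"
    and X: "compact X" "X \<noteq> {}" "X = (\<Union>i \<in> {1..N}. (\<lambda>x. lam * x + b i) ` X)"
    and \<mu>: "sets \<mu> = sets borel" "emeasure \<mu> (space \<mu>) = 1"
      "\<forall>A \<in> sets borel. emeasure \<mu> A =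
         (\<Sum>i = 1..N. ennreal (p i) * emeasure \<mu> ((\<lambda>x. lam * x + b i) -` A))"
    and H: "0 < hausdorff_measure \<alpha> X" "hausdorff_measure \<alpha> X < \<infinity>"
    and ac: "hausdorff_abs_cont \<mu> \<alpha> X"
  shows "((\<exists>\<nu>. frame_measure \<mu> \<nu>) \<longrightarrow> p 1 = p N) \<and>
         ((\<alpha> = 1 \<and> (\<exists>\<nu>. frame_measure \<mu> \<nu>)) \<longrightarrow>
            (\<forall>j \<in> {1..N}. p j \<le> lam) \<and> p 1 = lam \<and> p N = lam)"
proof -
  \<comment> \<open>A single map would need \<open>b 1\<close> to be both 0 and
    \<open>1 - lam\<close>.\<close>
  have N2: "2 \<le> N"
  proof (rule ccontr)
    assume "\<not> 2 \<le> N"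
    then have "N = 1" using N by simp
    then show False using b lam by simp
  qed
  have b_mono: "strict_mono_on {1..N} b"
  proof (rule strict_mono_onI)
    fix r s assume "r \<in> {1..N}" "s \<in> {1..N}" "r < s"
    then show "b r < b s"
    proof (induction s)
      case (Suc s)
      then have "b s < b (Suc s)" using b(3) by auto
      with Suc show ?case by (cases "r = s") auto
    qed simp
  qed
  have bb: "0 \<le> b i" "b i \<le> 1 - lam" if "i \<in> {1..N}" for i
    using mono_onD[OF strict_mono_on_imp_mono_on[OF b_mono], of 1 i]
      mono_onD[OF strict_mono_on_imp_mono_on[OF b_mono], of i N] that N b(1,2) by auto
  \<comment> \<open>The maximum \<open>u\<close> and the minimum \<open>l\<close> of
    \<open>X\<close> are themselves images of points of \<open>X\<close>, hence
    \<open>u \<le> lam * u + (1 - lam)\<close> and \<open>lam * l \<le> l\<close>.\<close>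
  have X_sub: "X \<subseteq> {0..1}"
  proof -
    obtain u where u: "u \<in> X" "\<And>x. x \<in> X \<Longrightarrow> x \<le> u"
      using compact_attains_sup[OF X(1,2)] by blast
    obtain l where l: "l \<in> X" "\<And>x. x \<in> X \<Longrightarrow> l \<le> x"
      using compact_attains_inf[OF X(1,2)] by blast
    obtain i x where i: "i \<in> {1..N}" "x \<in> X" "u = lam * x + b i"
      using u(1) by (subst (asm) X(3)) auto
    have "u \<le> lam * u + (1 - lam)"
      using i u(2)[OF i(2)] bb[OF i(1)] lam by (auto intro!: add_mono mult_left_mono)
    then have "(1 - lam) * u \<le> (1 - lam) * 1" by (simp add: algebra_simps)
    then have u1: "u \<le> 1" using lam by simp
    obtain i x where i: "i \<in> {1..N}" "x \<in> X" "l = lam * x + b i"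
      using l(1) by (subst (asm) X(3)) auto
    have "lam * l + 0 \<le> l"
      using i l(2)[OF i(2)] bb[OF i(1)] lam unfolding i(3) by (intro add_mono mult_left_mono) auto
    then have "0 \<le> (1 - lam) * l" by (simp add: algebra_simps)
    then have "0 \<le> l" using lam by (simp add: zero_le_mult_iff)
    with u1 u l show ?thesis by force
  qed
  have Xb: "X \<in> sets borel" using X(1) by (simp add: borel_closed compact_imp_closed)
  have supp: "AE x in \<mu>. x \<in> X"
  proof (rule AE_I')
    \<comment> \<open>The complement meets \<open>X\<close> in the empty set, which has Hausdorff
      measure 0.\<close>
    have "emeasure \<mu> (- X) = 0"
      using ac Xb unfolding hausdorff_abs_cont_def by (auto simp: hausdorff_measure_empty)
    then show "- X \<in> null_sets \<mu>" using Xb \<mu>(1) by (auto simp: null_sets_def)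
  qed auto
  interpret self_similar_measure lam N b p X \<mu>
    by unfold_locales (use lam N2 b(1,2) b_mono p X_sub Xb X(3) \<mu> supp in auto)
  have leb: "absolutely_continuous lborel \<mu>" if "\<alpha> = 1"
    unfolding absolutely_continuous_def
  proof
    fix A :: "real set" assume A: "A \<in> null_sets lborel"
    then have Ab: "A \<in> sets borel" by auto
    have "emeasure lborel (A \<inter> X) \<le> emeasure lborel A" using Ab by (intro emeasure_mono) auto
    then have "emeasure lborel (A \<inter> X) = 0" using A by auto
    then have "hausdorff_measure \<alpha> (A \<inter> X) = 0"
      using hausdorff_measure_1_null[of "A \<inter> X"] Ab Xb that by auto
    then show "A \<in> null_sets \<mu>"
      using ac Ab \<mu>(1) by (auto simp: hausdorff_abs_cont_def null_sets_def)
  qed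
  show ?thesis
    \<comment> \<open>For the second claim, \<open>p 1\<close> is bounded by \<open>lam\<close> from
      both sides, and \<open>p N\<close> equals \<open>p 1\<close>.\<close>
    using end_weights_eq weight_le_ratio[OF _ leb] ratio_le_end_weight[OF _ leb] N
    by (auto intro!: antisym)
qed

end
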